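(* Consider a combination of $N$ adaptive filters whose updates all have the form $$\boldsymbol w_{n,i}=\boldsymbol w_{n,a}+\mu_n\,\boldsymbol p_i(\boldsymbol w_{n,a}),\qquad n=1,\dots,N,$$ where $\mu_n$ is the step size of filter $n$ and $\boldsymbol p_i$ is the (common) update direction at iteration $i$. Suppose that coefficients feedback occurs at every iteration, i.e. $\boldsymbol w_{n,a}=\boldsymbol w_{i-1}$ for all $n$ and $i$, where $\boldsymbol w_i=\sum_{n=1}^N\eta_n(i)\,\boldsymbol w_{n,i}$ is the output of the combination, and that the combination is unbiased, i.e. $\sum_{n=1}^N\eta_n(i)=1$ for all $i$. Then the output of the combination satisfies $$\boldsymbol w_i=\boldsymbol w_{i-1}+\hat\mu(i)\,\boldsymbol p_i(\boldsymbol w_{i-1}),\qquad \hat\mu(i)=\sum_{n=1}^N\eta_n(i)\,\mu_n,$$ i.e. it has the form of a variable step size version of its component filters.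
   Context: $\boldsymbol w_{n,i}\in\mathbb R^M$ is the coefficient vector of the $n$-th component filter at iteration $i$; $\boldsymbol w_{n,a}\in\mathbb R^M$ is the a priori coefficient vector that it updates; $\eta_n(i)\in\mathbb R$ are the supervising parameters. The coefficients feedback topology with cycle period $L$ sets $\boldsymbol w_{n,a}=\boldsymbol w_{i-1}$ when $i$ is a multiple of $L$ and $\boldsymbol w_{n,a}=\boldsymbol w_{n,i-1}$ otherwise; here $L=1$. *)

theory Defs
  imports "HOL-Analysis.Analysis"
begin

text \<open>
  Filters are numbered \<open>1, \<dots>, N\<close> and iterations \<open>1, 2, \<dots>\<close>; index \<open>0\<close> of an iteration-indexed
  sequence is its initial condition. A family \<open>w n i\<close> is indexed first by the filter \<open>n\<close> and then
  by the iteration \<open>i\<close>. The relations below constrain only \<open>n \<in> {1..N}\<close> and \<open>i \<ge> 1\<close>.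
\<close>

definition component_updates ::
  "nat \<Rightarrow> (nat \<Rightarrow> real) \<Rightarrow> (nat \<Rightarrow> real ^ 'M \<Rightarrow> real ^ 'M) \<Rightarrow>
   (nat \<Rightarrow> nat \<Rightarrow> real ^ 'M) \<Rightarrow> (nat \<Rightarrow> nat \<Rightarrow> real ^ 'M) \<Rightarrow> bool"
where
  "component_updates N mu p wa w \<longleftrightarrow>
     (\<forall>n\<in>{1..N}. \<forall>i\<ge>1. w n i = wa n i + mu n *\<^sub>R p i (wa n i))"

definition combination_output ::
  "nat \<Rightarrow> (nat \<Rightarrow> nat \<Rightarrow> real) \<Rightarrow> (nat \<Rightarrow> nat \<Rightarrow> real ^ 'M) \<Rightarrow> (nat \<Rightarrow> real ^ 'M) \<Rightarrow> bool"
where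
  "combination_output N eta w wout \<longleftrightarrow>
     (\<forall>i\<ge>1. wout i = (\<Sum>n=1..N. eta n i *\<^sub>R w n i))"

definition unbiased_combination :: "nat \<Rightarrow> (nat \<Rightarrow> nat \<Rightarrow> real) \<Rightarrow> bool"
where
  "unbiased_combination N eta \<longleftrightarrow> (\<forall>i\<ge>1. (\<Sum>n=1..N. eta n i) = 1)"

definition coefficients_feedback ::
  "nat \<Rightarrow> nat \<Rightarrow> (nat \<Rightarrow> real ^ 'M) \<Rightarrow> (nat \<Rightarrow> nat \<Rightarrow> real ^ 'M) \<Rightarrow>
   (nat \<Rightarrow> nat \<Rightarrow> real ^ 'M) \<Rightarrow> bool"
where
  "coefficients_feedback L N wout w wa \<longleftrightarrow>
     (\<forall>n\<in>{1..N}. \<forall>i\<ge>1. wa n i = (if L dvd i then wout (i - 1) else w n (i - 1)))"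

end

theory Submission
  imports Defs
begin

text \<open>Feedback at every iteration makes all component filters start from the same vector
  \<open>wout (i - 1)\<close>. They therefore share one update direction and differ only in the
  scalar \<open>mu n\<close>. Weights that sum to one reproduce the common starting point and
  average the step sizes. Each iteration is handled separately, without induction, and
  \<open>p i\<close> is evaluated at a single point, so it may be nonlinear.\<close>

theorem mainTheorem3:
  fixes N :: nat
    and mu :: "nat \<Rightarrow> real"
    and eta :: "nat \<Rightarrow> nat \<Rightarrow> real"
    and p :: "nat \<Rightarrow> real ^ 'M \<Rightarrow> real ^ 'M"
    and w wa :: "nat \<Rightarrow> nat \<Rightarrow> real ^ 'M"
    and wout :: "nat \<Rightarrow> real ^ 'M"
  assumes "component_updates N mu p wa w"
    and "coefficients_feedback 1 N wout w wa"
    and "combination_output N eta w wout"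
    and "unbiased_combination N eta"
  shows "\<forall>i\<ge>1. wout i = wout (i - 1) + (\<Sum>n=1..N. eta n i * mu n) *\<^sub>R p i (wout (i - 1))"
proof (intro allI impI)
  fix i :: nat
  assume i: "i \<ge> 1"
  let ?v = "wout (i - 1)"
  have w_eq: "w n i = ?v + mu n *\<^sub>R p i ?v" if "n \<in> {1..N}" for n
  proof -
    \<comment> \<open>Since 1 divides every \<open>i\<close>, the conditional in
      \<open>coefficients_feedback\<close> always takes its feedback branch.\<close>
    have "wa n i = ?v"
      using assms(2) that i by (simp add: coefficients_feedback_def)
    then show ?thesis
      using assms(1) that i by (simp add: component_updates_def)
  qed
  have "wout i = (\<Sum>n=1..N. eta n i *\<^sub>R w n i)"
    using assms(3) i by (simp add: combination_output_def)
  also have "\<dots> = (\<Sum>n=1..N. eta n i *\<^sub>R ?v + (eta n i * mu n) *\<^sub>R p i ?v)"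
    by (rule sum.cong) (simp_all add: w_eq scaleR_add_right)
  \<comment> \<open>Neither \<open>?v\<close> nor \<open>p i ?v\<close> depends on \<open>n\<close>,
    so both factor out of the sum.\<close>
  also have "\<dots> = (\<Sum>n=1..N. eta n i) *\<^sub>R ?v + (\<Sum>n=1..N. eta n i * mu n) *\<^sub>R p i ?v"
    by (simp add: sum.distrib scaleR_sum_left)
  also have "(\<Sum>n=1..N. eta n i) = 1"
    using assms(4) i by (simp add: unbiased_combination_def)
  finally show "wout i = ?v + (\<Sum>n=1..N. eta n i * mu n) *\<^sub>R p i ?v"
    by simp
qed

end
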